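(* Let $R=\mathbb Z$ or $R=\mathbb Z_p$ with $p\ge3$ prime, let $X$ be a $\Delta$-complex, and let $A=C^*(X;R)$. Let $u_1,u_2\in H^1(A)$ with $u_1\cup u_2=0$. Then the indeterminacy of the restricted Massey triple product $\langle u_1,u_1,u_2\rangle_r$ is the set $u_1\cup H^1(A)$.
   Context: $C^*(X;R)$ is the simplicial cochain algebra of the $\Delta$-complex $X$ (sets $X_n$ of $n$-simplices with face maps $d_i$, $d_id_j=d_{j-1}d_i$ for $i<j$), with $(du)(x)=u(\partial x)$, $\partial=\sum_i(-1)^id_i$, and $(u\cup v)([0,\dots,p+q])=u([0,\dots,p])v([p,\dots,p+q])$ for $u\in C^p$, $v\in C^q$. For a $1$-cochain $a$, $\zeta_2(a)$ is the $1$-cochain $\zeta_2(a)(e)=a(e)(a(e)-1)/2$ on $1$-simplices $e$. Restricted Massey triple product: for $u_1,u_2\in H^1(A)$ with $u_1\cup u_2=0$, $\langle u_1,u_1,u_2\rangle_r$ is the subset of $H^2(A)$ of all classes $[\gamma(a_1,a_2,a_{1,2})]$ with $\gamma(a_1,a_2,a_{1,2})=a_1\cup a_{1,2}-\zeta_2(a_1)\cup a_2$, where $a_i$ are cocycles with $[a_i]=u_i$ and $a_{1,2}\in A^1$ satisfies $da_{1,2}=a_1\cup a_2$ (then $\gamma$ is a $2$-cocycle, as $d\zeta_2(a_1)=-a_1\cup a_1$). Its indeterminacy is the set of all differences of two elements of it; the statement thus says that $\langle u_1,u_1,u_2\rangle_r$ is a coset of $u_1\cup H^1(A)$ in $H^2(A)$.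 *)

theory Defs
  imports "HOL-Algebra.IntRing" "HOL-Algebra.Product_Groups" "HOL-Number_Theory.Residues"
begin

text \<open>
  A \<open>\<Delta>\<close>-complex is given by its sets of \<open>n\<close>-simplices and its face maps; \<open>face X n i\<close> is the map
  \<open>d\<^sub>i\<close> from \<open>n\<close>-simplices to \<open>(n - 1)\<close>-simplices, relevant for \<open>n \<ge> 1\<close> and \<open>i \<le> n\<close> only.
\<close>

record 'a delta_data =
  simplices :: "nat \<Rightarrow> 'a set"
  face :: "nat \<Rightarrow> nat \<Rightarrow> 'a \<Rightarrow> 'a"

locale delta_complex =
  fixes X :: "'a delta_data"
  assumes face_closed:
    "\<lbrakk>i \<le> Suc n; x \<in> simplices X (Suc n)\<rbrakk> \<Longrightarrow> face X (Suc n) i x \<in> simplices X n"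
  and face_face:
    "\<lbrakk>i < j; j \<le> Suc (Suc n); x \<in> simplices X (Suc (Suc n))\<rbrakk> \<Longrightarrow>
      face X (Suc n) i (face X (Suc (Suc n)) j x) =
      face X (Suc n) (j - 1) (face X (Suc (Suc n)) i x)"

text \<open>
  Cochain and cohomology groups are additive groups in the mathematics, but are written here as
  multiplicative \<^typ>\<open>'b monoid\<close> records, as required by \<^const>\<open>FactGroup\<close>: their \<open>\<otimes>\<close>, \<open>inv\<close> and
  \<open>\<one>\<close> are addition, negation and zero.
\<close>

definition cochain_group :: "'a delta_data \<Rightarrow> 'r ring \<Rightarrow> nat \<Rightarrow> ('a \<Rightarrow> 'r) monoid" where
  "cochain_group X R n = product_group (simplices X n) (\<lambda>_. add_monoid R)"

definition coboundary ::
    "'a delta_data \<Rightarrow> 'r ring \<Rightarrow> nat \<Rightarrow> ('a \<Rightarrow> 'r) \<Rightarrow> 'a \<Rightarrow> 'r" where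
  "coboundary X R n u =
    (\<lambda>x\<in>simplices X (Suc n).
      \<Oplus>\<^bsub>R\<^esub>i\<in>{..Suc n}. ((\<ominus>\<^bsub>R\<^esub> \<one>\<^bsub>R\<^esub>) [^]\<^bsub>R\<^esub> i) \<otimes>\<^bsub>R\<^esub> u (face X (Suc n) i x))"

definition cocycles :: "'a delta_data \<Rightarrow> 'r ring \<Rightarrow> nat \<Rightarrow> ('a \<Rightarrow> 'r) set" where
  "cocycles X R n =
    kernel (cochain_group X R n) (cochain_group X R (Suc n)) (coboundary X R n)"

definition coboundaries :: "'a delta_data \<Rightarrow> 'r ring \<Rightarrow> nat \<Rightarrow> ('a \<Rightarrow> 'r) set" where
  "coboundaries X R n =
    (case n of
      0 \<Rightarrow> {\<one>\<^bsub>cochain_group X R 0\<^esub>}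
    | Suc m \<Rightarrow> coboundary X R m ` carrier (cochain_group X R m))"

definition cohomology :: "'a delta_data \<Rightarrow> 'r ring \<Rightarrow> nat \<Rightarrow> ('a \<Rightarrow> 'r) set monoid" where
  "cohomology X R n =
    (cochain_group X R n)\<lparr>carrier := cocycles X R n\<rparr> Mod coboundaries X R n"

definition cohomology_class ::
    "'a delta_data \<Rightarrow> 'r ring \<Rightarrow> nat \<Rightarrow> ('a \<Rightarrow> 'r) \<Rightarrow> ('a \<Rightarrow> 'r) set" where
  "cohomology_class X R n a = coboundaries X R n #>\<^bsub>cochain_group X R n\<^esub> a"

text \<open>
  For a \<open>(p + q)\<close>-simplex \<open>x = [0,\<dots>,p+q]\<close>, \<open>front_face X p q x\<close> is its \<open>p\<close>-face \<open>[0,\<dots>,p]\<close>, obtained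
  by repeatedly deleting the last vertex, and \<open>back_face X p q x\<close> is its \<open>q\<close>-face \<open>[p,\<dots>,p+q]\<close>,
  obtained by repeatedly deleting the first vertex.
\<close>

primrec front_face :: "'a delta_data \<Rightarrow> nat \<Rightarrow> nat \<Rightarrow> 'a \<Rightarrow> 'a" where
  "front_face X p 0 x = x"
| "front_face X p (Suc q) x = front_face X p q (face X (p + Suc q) (p + Suc q) x)"

primrec back_face :: "'a delta_data \<Rightarrow> nat \<Rightarrow> nat \<Rightarrow> 'a \<Rightarrow> 'a" where
  "back_face X 0 q x = x"
| "back_face X (Suc p) q x = back_face X p q (face X (Suc p + q) 0 x)"

definition cup ::
    "'a delta_data \<Rightarrow> 'r ring \<Rightarrow> nat \<Rightarrow> nat \<Rightarrow> ('a \<Rightarrow> 'r) \<Rightarrow> ('a \<Rightarrow> 'r) \<Rightarrow> 'a \<Rightarrow> 'r" where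
  "cup X R p q u v =
    (\<lambda>x\<in>simplices X (p + q). u (front_face X p q x) \<otimes>\<^bsub>R\<^esub> v (back_face X p q x))"

text \<open>
  The product of two classes is the class of the product of any representatives; as in
  \<^const>\<open>rcoset_mult\<close>, this is expressed by a union over all representatives.
\<close>

definition cohomology_cup ::
    "'a delta_data \<Rightarrow> 'r ring \<Rightarrow> nat \<Rightarrow> nat \<Rightarrow>
      ('a \<Rightarrow> 'r) set \<Rightarrow> ('a \<Rightarrow> 'r) set \<Rightarrow> ('a \<Rightarrow> 'r) set" where
  "cohomology_cup X R p q U V =
    (\<Union>a\<in>U. \<Union>b\<in>V. cohomology_class X R (p + q) (cup X R p q a b))"

text \<open>
  \<open>zeta2 X R a\<close> maps a \<open>1\<close>-simplex \<open>e\<close> to \<open>a(e)(a(e) - 1)/2\<close>. The quotient by \<open>2\<close> is the element of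
  \<open>R\<close> whose double is \<open>a(e)(a(e) - 1)\<close>; it exists and is unique both in the integers and in the
  integers modulo an odd prime.
\<close>

definition zeta2 :: "'a delta_data \<Rightarrow> 'r ring \<Rightarrow> ('a \<Rightarrow> 'r) \<Rightarrow> 'a \<Rightarrow> 'r" where
  "zeta2 X R a =
    (\<lambda>e\<in>simplices X 1.
      THE c. c \<in> carrier R \<and> c \<oplus>\<^bsub>R\<^esub> c = a e \<otimes>\<^bsub>R\<^esub> (a e \<ominus>\<^bsub>R\<^esub> \<one>\<^bsub>R\<^esub>))"

definition massey_cochain ::
    "'a delta_data \<Rightarrow> 'r ring \<Rightarrow> ('a \<Rightarrow> 'r) \<Rightarrow> ('a \<Rightarrow> 'r) \<Rightarrow> ('a \<Rightarrow> 'r) \<Rightarrow> 'a \<Rightarrow> 'r" where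
  "massey_cochain X R a1 a2 a12 =
    cup X R 1 1 a1 a12 \<otimes>\<^bsub>cochain_group X R 2\<^esub>
      inv\<^bsub>cochain_group X R 2\<^esub> (cup X R 1 1 (zeta2 X R a1) a2)"

definition restricted_massey ::
    "'a delta_data \<Rightarrow> 'r ring \<Rightarrow> ('a \<Rightarrow> 'r) set \<Rightarrow> ('a \<Rightarrow> 'r) set \<Rightarrow> ('a \<Rightarrow> 'r) set set" where
  "restricted_massey X R u1 u2 =
    {cohomology_class X R 2 (massey_cochain X R a1 a2 a12) | a1 a2 a12.
      a1 \<in> cocycles X R 1 \<and> cohomology_class X R 1 a1 = u1 \<and>
      a2 \<in> cocycles X R 1 \<and> cohomology_class X R 1 a2 = u2 \<and>
      a12 \<in> carrier (cochain_group X R 1) \<and> coboundary X R 1 a12 = cup X R 1 1 a1 a2}"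

definition indeterminacy :: "'g monoid \<Rightarrow> 'g set \<Rightarrow> 'g set" where
  "indeterminacy G S = {x \<otimes>\<^bsub>G\<^esub> inv\<^bsub>G\<^esub> y | x y. x \<in> S \<and> y \<in> S}"

end

theory Submission
  imports Defs
begin

text \<open>
  Fix a choice of \<open>a\<^sub>1\<close>, \<open>a\<^sub>2\<close>, \<open>a\<^sub>1\<^sub>2\<close>, which exists because \<open>u\<^sub>1 \<union> u\<^sub>2 = 0\<close>, and write \<open>\<gamma>\<close> for the
  resulting \<open>2\<close>-cocycle. Any other choice is reached in three steps.

  \<^item> Replace \<open>a\<^sub>1\<close> by \<open>a\<^sub>1 + \<delta>b\<close> and \<open>a\<^sub>1\<^sub>2\<close> by \<open>a\<^sub>1\<^sub>2 + b \<union> a\<^sub>2\<close>. This changes \<open>\<gamma>\<close> by the coboundary of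
    \<open>b \<union> a\<^sub>1\<^sub>2 + w \<union> a\<^sub>2\<close>, where \<open>w(v) = b(v)(b(v) + 1)/2\<close> on vertices \<open>v\<close>.
  \<^item> Replace \<open>a\<^sub>2\<close> by \<open>a\<^sub>2 + \<delta>c\<close> and \<open>a\<^sub>1\<^sub>2\<close> by \<open>a\<^sub>1\<^sub>2 - a\<^sub>1 \<union> c\<close>. This changes \<open>\<gamma>\<close> by the coboundary of
    \<open>\<zeta>\<^sub>2(a\<^sub>1) \<union> c\<close>.
  \<^item> With \<open>a\<^sub>1\<close> and \<open>a\<^sub>2\<close> fixed, two choices of \<open>a\<^sub>1\<^sub>2\<close> differ by a cocycle \<open>z\<close>, and adding \<open>z\<close> to
    \<open>a\<^sub>1\<^sub>2\<close> changes \<open>\<gamma>\<close> by \<open>a\<^sub>1 \<union> z\<close>.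

  Only the last step is visible in cohomology, and there \<open>z\<close> is an arbitrary \<open>1\<close>-cocycle. So the
  restricted Massey product is the coset of \<open>[\<gamma>]\<close> modulo the subgroup \<open>u\<^sub>1 \<union> H\<^sup>1\<close>
  (\<open>restricted_massey_rcoset\<close>), and the differences of two elements of a coset fill the subgroup
  (\<open>indeterminacy_rcoset\<close>).

  About \<open>\<zeta>\<^sub>2\<close> only the rule \<open>(x + y) choose 2 = (x choose 2) + (y choose 2) + x y\<close> is needed
  (\<open>binom2_add\<close>). It holds in every commutative ring without \<open>2\<close>-torsion in which each \<open>x (x - 1)\<close>
  is divisible by \<open>2\<close>, and the argument is carried out over such a ring. Simplices of dimension at
  most \<open>3\<close> suffice, so all cochain identities are checked by evaluating both sides on an edge, a
  triangle or a tetrahedron.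
\<close>

text \<open>Degrees are written \<open>0\<close>, \<open>1\<close>, \<open>2\<close>, \<open>3\<close> throughout, so \<open>1\<close> must not be unfolded to \<open>Suc 0\<close>.\<close>

declare One_nat_def [simp del]

section \<open>Rings with binomial coefficients \<open>x choose 2\<close>\<close>

text \<open>
  The commutative rings in which \<open>x (x - 1)/2\<close> exists and is unique for every \<open>x\<close>.
\<close>

locale halving_ring = cring R for R :: "'r ring" (structure) +
  assumes double_eq_zero: "\<lbrakk>x \<in> carrier R; x \<oplus> x = \<zero>\<rbrakk> \<Longrightarrow> x = \<zero>"
    and ex_half: "x \<in> carrier R \<Longrightarrow> \<exists>c\<in>carrier R. c \<oplus> c = x \<otimes> (x \<ominus> \<one>)"
begin

lemma double_inject:
  assumes "x \<in> carrier R" "y \<in> carrier R" "x \<oplus> x = y \<oplus> y"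
  shows "x = y"
proof -
  have "(x \<ominus> y) \<oplus> (x \<ominus> y) = (x \<oplus> x) \<ominus> (y \<oplus> y)"
    using assms(1,2) by algebra
  also have "\<dots> = \<zero>"
    unfolding assms(3) using assms(2) by (simp add: minus_eq r_neg)
  finally have "x \<ominus> y = \<zero>"
    by (rule double_eq_zero[rotated]) (use assms in simp)
  then show ?thesis
    using r_right_minus_eq[OF assms(1,2)] by blast
qed

text \<open>
  The binomial coefficient \<open>x choose 2\<close>, as the element whose double is \<open>x (x - 1)\<close>; meaningful for
  \<open>x\<close> in the carrier only.
\<close>

definition binom2 :: "'r \<Rightarrow> 'r" where
  "binom2 x = (THE c. c \<in> carrier R \<and> c \<oplus> c = x \<otimes> (x \<ominus> \<one>))"

lemma binom2:
  assumes "x \<in> carrier R"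
  shows binom2_closed: "binom2 x \<in> carrier R"
    and binom2_double: "binom2 x \<oplus> binom2 x = x \<otimes> (x \<ominus> \<one>)"
proof -
  have "\<exists>!c. c \<in> carrier R \<and> c \<oplus> c = x \<otimes> (x \<ominus> \<one>)"
  proof (rule ex_ex1I)
    show "\<exists>c. c \<in> carrier R \<and> c \<oplus> c = x \<otimes> (x \<ominus> \<one>)"
      using ex_half[OF assms] by blast
  qed (auto intro: double_inject)
  from theI'[OF this] show "binom2 x \<in> carrier R" "binom2 x \<oplus> binom2 x = x \<otimes> (x \<ominus> \<one>)"
    unfolding binom2_def by blast+
qed

lemma binom2_add:
  assumes "x \<in> carrier R" "y \<in> carrier R"
  shows "binom2 (x \<oplus> y) = binom2 x \<oplus> binom2 y \<oplus> x \<otimes> y"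
proof (rule double_inject)
  note [simp] = assms binom2_closed
  let ?s = "binom2 x \<oplus> binom2 y \<oplus> x \<otimes> y"
  show "binom2 (x \<oplus> y) \<in> carrier R" "?s \<in> carrier R"
    by simp_all
  have "?s \<oplus> ?s = (binom2 x \<oplus> binom2 x) \<oplus> (binom2 y \<oplus> binom2 y) \<oplus> (x \<otimes> y \<oplus> x \<otimes> y)"
    by (simp add: a_ac)
  also have "\<dots> = x \<otimes> (x \<ominus> \<one>) \<oplus> y \<otimes> (y \<ominus> \<one>) \<oplus> (x \<otimes> y \<oplus> x \<otimes> y)"
    by (simp add: binom2_double)
  also have "\<dots> = (x \<oplus> y) \<otimes> ((x \<oplus> y) \<ominus> \<one>)"
    using assms by algebra
  finally show "binom2 (x \<oplus> y) \<oplus> binom2 (x \<oplus> y) = ?s \<oplus> ?s"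
    by (simp add: binom2_double)
qed

end

lemma halving_ring_int: "halving_ring \<Z>"
proof -
  interpret cring \<Z> by (rule int_is_cring)
  show ?thesis
  proof unfold_locales
    fix x :: int
    have minus: "a \<ominus>\<^bsub>\<Z>\<^esub> b = a - b" for a b
      by (simp add: a_minus_def int_a_inv_eq)
    have "even (x * (x - 1))" by simp
    then show "\<exists>c\<in>carrier \<Z>. c \<oplus>\<^bsub>\<Z>\<^esub> c = x \<otimes>\<^bsub>\<Z>\<^esub> (x \<ominus>\<^bsub>\<Z>\<^esub> \<one>\<^bsub>\<Z>\<^esub>)"
      unfolding minus by (intro bexI[of _ "x * (x - 1) div 2"]) auto
  qed simp
qed

lemma halving_ring_if_two_unit:
  fixes R :: "'r ring" (structure)
  assumes "cring R" "\<one> \<oplus> \<one> \<in> Units R"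
  shows "halving_ring R"
proof -
  interpret cring R by (rule assms(1))
  define t where "t = inv (\<one> \<oplus> \<one>)"
  have t: "t \<in> carrier R" "(\<one> \<oplus> \<one>) \<otimes> t = \<one>"
    using assms(2) by (simp_all add: t_def)
  have half: "t \<otimes> y \<oplus> t \<otimes> y = y" "t \<otimes> (y \<oplus> y) = y" if "y \<in> carrier R" for y
  proof -
    have "t \<otimes> y \<oplus> t \<otimes> y = ((\<one> \<oplus> \<one>) \<otimes> t) \<otimes> y"
      using that t(1) by algebra
    then show *: "t \<otimes> y \<oplus> t \<otimes> y = y"
      using that t by simp
    show "t \<otimes> (y \<oplus> y) = y"
      using that t(1) * by (simp add: r_distr)
  qed
  show ?thesis
  proof unfold_locales
    show "x = \<zero>" if "x \<in> carrier R" "x \<oplus> x = \<zero>" for x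
    proof -
      have "x = t \<otimes> (x \<oplus> x)"
        using half(2)[OF that(1)] by (rule sym)
      also have "\<dots> = \<zero>"
        unfolding that(2) using t(1) by (rule r_null)
      finally show ?thesis .
    qed
    show "\<exists>c\<in>carrier R. c \<oplus> c = x \<otimes> (x \<ominus> \<one>)" if "x \<in> carrier R" for x
      using that t(1)
      by (intro bexI[of _ "t \<otimes> (x \<otimes> (x \<ominus> \<one>))"] half(1)) simp_all
  qed
qed

lemma halving_ring_residue_ring:
  fixes p :: int
  assumes "prime p" "p \<ge> 3"
  shows "halving_ring (residue_ring p)"
proof -
  define q where "q = nat p"
  have p: "p = int q"
    using assms(2) by (simp add: q_def)
  have q: "prime q" "q \<ge> 3"
    using assms by (simp_all add: p)
  let ?R = "residue_ring (int q)"
  interpret residues_prime q ?R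
    by (simp add: residues_prime_def q(1))
  have two: "\<one>\<^bsub>?R\<^esub> \<oplus>\<^bsub>?R\<^esub> \<one>\<^bsub>?R\<^esub> = 2"
    using q(2) by (simp add: res_add_eq res_one_eq)
  have "2 \<in> Units ?R"
    using q(2) by (simp add: res_prime_units_eq)
  then show ?thesis
    unfolding p by (intro halving_ring_if_two_unit cring) (simp add: two)
qed

section \<open>Cochains in low degrees\<close>

text \<open>
  Cochains on \<open>X\<close> with coefficients in a commutative ring. The cochain groups are written
  multiplicatively, so \<open>u \<otimes>\<^bsub>C n\<^esub> v\<close> is the sum and \<open>inv\<^bsub>C n\<^esub> u\<close> the negative of cochains.
\<close>

locale cochain_complex = delta_complex X + cring R
  for X :: "'a delta_data" and R :: "'r ring" (structure)
begin

abbreviation "S \<equiv> simplices X"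
abbreviation "C \<equiv> cochain_group X R"
abbreviation "\<delta> \<equiv> coboundary X R"
abbreviation "Z \<equiv> cocycles X R"
abbreviation "B \<equiv> coboundaries X R"
abbreviation "cls \<equiv> cohomology_class X R"
abbreviation "H \<equiv> cohomology X R"

lemma cochain_carrier: "carrier (C n) = (S n \<rightarrow>\<^sub>E carrier R)"
  by (simp add: cochain_group_def)

lemma cochain_closed [simp]: "\<lbrakk>u \<in> carrier (C n); x \<in> S n\<rbrakk> \<Longrightarrow> u x \<in> carrier R"
  by (auto simp: cochain_carrier)

lemma cochain_eqI:
  assumes "u \<in> carrier (C n)" "v \<in> carrier (C n)" "\<And>x. x \<in> S n \<Longrightarrow> u x = v x"
  shows "u = v"
  using assms by (auto simp: cochain_carrier intro: PiE_ext)

lemma restrict_cochain: "(\<And>x. x \<in> S n \<Longrightarrow> f x \<in> carrier R) \<Longrightarrow> restrict f (S n) \<in> carrier (C n)"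
  by (auto simp: cochain_carrier)

lemma cochain_comm_group: "comm_group (C n)"
proof -
  interpret P: group "C n"
    unfolding cochain_group_def by (rule product_group, rule a_group)
  show ?thesis
    by (rule P.group_comm_groupI) (auto simp: cochain_group_def a_comm PiE_iff intro!: restrict_ext)
qed

sublocale C: comm_group "C n" for n
  by (rule cochain_comm_group)

lemma cochain_one_apply [simp]: "x \<in> S n \<Longrightarrow> \<one>\<^bsub>C n\<^esub> x = \<zero>"
  by (simp add: cochain_group_def)

lemma cochain_mult_apply [simp]: "x \<in> S n \<Longrightarrow> (u \<otimes>\<^bsub>C n\<^esub> v) x = u x \<oplus> v x"
  by (simp add: cochain_group_def)

lemma cochain_inv_apply [simp]:
  "\<lbrakk>u \<in> carrier (C n); x \<in> S n\<rbrakk> \<Longrightarrow> (inv\<^bsub>C n\<^esub> u) x = \<ominus> u x"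
  using inv_product_group[of u "S n" "\<lambda>_. add_monoid R", OF _ a_group]
  unfolding cochain_carrier cochain_group_def a_inv_def by (simp del: inv_product_group)

lemma coboundary_hom: "\<delta> n \<in> hom (C n) (C (Suc n))"
proof (rule homI)
  fix u v assume uv: "u \<in> carrier (C n)" "v \<in> carrier (C n)"
  have closed: "\<delta> n w \<in> carrier (C (Suc n))" if "w \<in> carrier (C n)" for w
    unfolding coboundary_def
    by (intro restrict_cochain finsum_closed) (use that face_closed in auto)
  then show "\<delta> n u \<in> carrier (C (Suc n))"
    using uv by blast
  show "\<delta> n (u \<otimes>\<^bsub>C n\<^esub> v) = \<delta> n u \<otimes>\<^bsub>C (Suc n)\<^esub> \<delta> n v"
  proof (rule cochain_eqI)
    fix x assume x: "x \<in> S (Suc n)"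
    have f: "face X (Suc n) i x \<in> S n" if "i \<in> {..Suc n}" for i
      using that x face_closed by simp
    have "\<delta> n (u \<otimes>\<^bsub>C n\<^esub> v) x = (\<Oplus>i\<in>{..Suc n}.
        (\<ominus> \<one>) [^] i \<otimes> u (face X (Suc n) i x) \<oplus> (\<ominus> \<one>) [^] i \<otimes> v (face X (Suc n) i x))"
      using x uv f
      by (simp add: coboundary_def del: finsum_Suc finsum_addf)
        (rule finsum_cong', auto simp: r_distr)
    also have "\<dots> = (\<delta> n u \<otimes>\<^bsub>C (Suc n)\<^esub> \<delta> n v) x"
      using x uv f
      by (subst finsum_addf) (auto simp: coboundary_def simp del: finsum_Suc)
    finally show "\<delta> n (u \<otimes>\<^bsub>C n\<^esub> v) x = (\<delta> n u \<otimes>\<^bsub>C (Suc n)\<^esub> \<delta> n v) x" .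
  qed (use uv closed in auto)
qed

sublocale \<delta>: group_hom "C n" "C (Suc n)" "\<delta> n" for n
  by unfold_locales (rule coboundary_hom)

sublocale \<delta>1: group_hom "C 1" "C 2" "\<delta> 1"
  using \<delta>.group_hom_axioms[of 1] by (simp add: Suc_1)

lemma coboundary_closed [simp]:
  "u \<in> carrier (C 0) \<Longrightarrow> \<delta> 0 u \<in> carrier (C 1)"
  "u \<in> carrier (C 1) \<Longrightarrow> \<delta> 1 u \<in> carrier (C 2)"
  "u \<in> carrier (C 2) \<Longrightarrow> \<delta> 2 u \<in> carrier (C 3)"
  using \<delta>.hom_closed[of u 0] \<delta>.hom_closed[of u 1] \<delta>.hom_closed[of u 2]
  by (simp_all add: numeral_eq_Suc One_nat_def)

lemma face_mem [simp]:
  "\<lbrakk>x \<in> S 1; i \<le> 1\<rbrakk> \<Longrightarrow> face X 1 i x \<in> S 0"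
  "\<lbrakk>x \<in> S 2; i \<le> 2\<rbrakk> \<Longrightarrow> face X 2 i x \<in> S 1"
  "\<lbrakk>x \<in> S 3; i \<le> 3\<rbrakk> \<Longrightarrow> face X 3 i x \<in> S 2"
  using face_closed[of i 0 x] face_closed[of i 1 x] face_closed[of i 2 x]
  by (simp_all add: numeral_eq_Suc One_nat_def)

text \<open>
  As rewrite rules, the face relations replace \<open>d\<^sub>i d\<^sub>j\<close> for \<open>i < j\<close> by \<open>d\<^sub>j\<^sub>-\<^sub>1 d\<^sub>i\<close>. Every vertex of a
  triangle, and every edge of a tetrahedron, thereby gets a unique name \<open>d\<^sub>i d\<^sub>j\<close> with \<open>i \<ge> j\<close>.
\<close>

lemma face_face_triangle [simp]:
  assumes "x \<in> S 2"
  shows "face X 1 0 (face X 2 1 x) = face X 1 0 (face X 2 0 x)"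
    and "face X 1 0 (face X 2 2 x) = face X 1 1 (face X 2 0 x)"
    and "face X 1 1 (face X 2 2 x) = face X 1 1 (face X 2 1 x)"
  using face_face[of 0 1 0 x] face_face[of 0 2 0 x] face_face[of 1 2 0 x] assms
  by (simp_all add: numeral_eq_Suc One_nat_def)

lemma face_face_tetrahedron [simp]:
  assumes "x \<in> S 3"
  shows "face X 2 0 (face X 3 1 x) = face X 2 0 (face X 3 0 x)"
    and "face X 2 0 (face X 3 2 x) = face X 2 1 (face X 3 0 x)"
    and "face X 2 0 (face X 3 3 x) = face X 2 2 (face X 3 0 x)"
    and "face X 2 1 (face X 3 2 x) = face X 2 1 (face X 3 1 x)"
    and "face X 2 1 (face X 3 3 x) = face X 2 2 (face X 3 1 x)"
    and "face X 2 2 (face X 3 3 x) = face X 2 2 (face X 3 2 x)"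
  using face_face[of 0 1 1 x] face_face[of 0 2 1 x] face_face[of 0 3 1 x]
    face_face[of 1 2 1 x] face_face[of 1 3 1 x] face_face[of 2 3 1 x] assms
  by (simp_all add: numeral_eq_Suc One_nat_def)

lemma coboundary_edge:
  assumes "u \<in> carrier (C 0)" "e \<in> S 1"
  shows "\<delta> 0 u e = u (face X 1 0 e) \<ominus> u (face X 1 1 e)"
proof -
  have m: "u (face X 1 i e) \<in> carrier R" if "i \<le> 1" for i
    using assms that by simp
  have "{..Suc 0} = {0,1::nat}" by auto
  then have "\<delta> 0 u e = u (face X 1 0 e) \<oplus> \<ominus> \<one> \<otimes> u (face X 1 1 e)"
    using assms m by (simp add: coboundary_def flip: One_nat_def)
  then show ?thesis
    using m[of 0] m[of 1] by (simp add: l_minus minus_eq)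
qed

lemma coboundary_triangle:
  assumes "u \<in> carrier (C 1)" "x \<in> S 2"
  shows "\<delta> 1 u x = u (face X 2 0 x) \<ominus> u (face X 2 1 x) \<oplus> u (face X 2 2 x)"
proof -
  have m: "u (face X 2 i x) \<in> carrier R" if "i \<le> 2" for i
    using assms that by simp
  have s: "{..2} = {0,1,2::nat}" "Suc 1 = 2" by auto
  have "\<delta> 1 u x = (\<Oplus>i\<in>{0,1,2}. (\<ominus> \<one>) [^] (i::nat) \<otimes> u (face X 2 i x))"
    using assms by (simp add: coboundary_def s)
  also have "\<dots> = u (face X 2 0 x) \<oplus> (\<ominus> \<one> \<otimes> u (face X 2 1 x)
      \<oplus> ((\<ominus> \<one>) \<otimes> (\<ominus> \<one>)) \<otimes> u (face X 2 2 x))"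
    using m[of 0] m[of 1] m[of 2] by (simp add: numeral_eq_Suc One_nat_def)
  also have "\<dots> = u (face X 2 0 x) \<ominus> u (face X 2 1 x) \<oplus> u (face X 2 2 x)"
    using m[of 0] m[of 1] m[of 2] by (simp add: l_minus minus_eq a_ac)
  finally show ?thesis .
qed

lemma coboundary_tetrahedron:
  assumes "u \<in> carrier (C 2)" "x \<in> S 3"
  shows "\<delta> 2 u x = u (face X 3 0 x) \<ominus> u (face X 3 1 x) \<oplus> u (face X 3 2 x) \<ominus> u (face X 3 3 x)"
proof -
  have m: "u (face X 3 i x) \<in> carrier R" if "i \<le> 3" for i
    using assms that by simp
  have s: "{..3} = {0,1,2,3::nat}" "Suc 2 = 3" by auto
  have "\<delta> 2 u x = (\<Oplus>i\<in>{0,1,2,3}. (\<ominus> \<one>) [^] (i::nat) \<otimes> u (face X 3 i x))"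
    using assms by (simp add: coboundary_def s)
  also have "\<dots> = u (face X 3 0 x) \<oplus> (\<ominus> \<one> \<otimes> u (face X 3 1 x)
      \<oplus> (((\<ominus> \<one>) \<otimes> (\<ominus> \<one>)) \<otimes> u (face X 3 2 x)
      \<oplus> ((\<ominus> \<one>) \<otimes> (\<ominus> \<one>) \<otimes> (\<ominus> \<one>)) \<otimes> u (face X 3 3 x)))"
    using m[of 0] m[of 1] m[of 2] m[of 3] by (simp add: numeral_eq_Suc One_nat_def)
  also have "\<dots> = u (face X 3 0 x) \<ominus> u (face X 3 1 x) \<oplus> u (face X 3 2 x) \<ominus> u (face X 3 3 x)"
    using m[of 0] m[of 1] m[of 2] m[of 3] by (simp add: l_minus minus_eq a_ac)
  finally show ?thesis .
qed

lemma coboundary_coboundary: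
  shows "u \<in> carrier (C 0) \<Longrightarrow> \<delta> 1 (\<delta> 0 u) = \<one>\<^bsub>C 2\<^esub>"
    and "v \<in> carrier (C 1) \<Longrightarrow> \<delta> 2 (\<delta> 1 v) = \<one>\<^bsub>C 3\<^esub>"
proof -
  assume u: "u \<in> carrier (C 0)"
  show "\<delta> 1 (\<delta> 0 u) = \<one>\<^bsub>C 2\<^esub>"
  proof (rule cochain_eqI)
    fix x assume x: "x \<in> S 2"
    define v0 v1 v2 where "v0 = u (face X 1 1 (face X 2 1 x))"
      and "v1 = u (face X 1 1 (face X 2 0 x))" and "v2 = u (face X 1 0 (face X 2 0 x))"
    have "v0 \<in> carrier R" "v1 \<in> carrier R" "v2 \<in> carrier R"
      using u x by (auto simp: v0_def v1_def v2_def)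
    then have "(v2 \<ominus> v1) \<ominus> (v2 \<ominus> v0) \<oplus> (v1 \<ominus> v0) = \<zero>"
      by algebra
    then show "\<delta> 1 (\<delta> 0 u) x = \<one>\<^bsub>C 2\<^esub> x"
      using u x by (simp add: coboundary_triangle coboundary_edge v0_def v1_def v2_def)
  qed (use u in auto)
next
  assume v: "v \<in> carrier (C 1)"
  show "\<delta> 2 (\<delta> 1 v) = \<one>\<^bsub>C 3\<^esub>"
  proof (rule cochain_eqI)
    fix x assume x: "x \<in> S 3"
    let ?e = "\<lambda>i j. v (face X 2 i (face X 3 j x))"
    have "\<delta> 2 (\<delta> 1 v) x =
        (?e 0 0 \<ominus> ?e 1 0 \<oplus> ?e 2 0) \<ominus> (?e 0 0 \<ominus> ?e 1 1 \<oplus> ?e 2 1)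
        \<oplus> (?e 1 0 \<ominus> ?e 1 1 \<oplus> ?e 2 2) \<ominus> (?e 2 0 \<ominus> ?e 2 1 \<oplus> ?e 2 2)"
      using v x by (simp add: coboundary_triangle coboundary_tetrahedron)
    moreover have "?e i j \<in> carrier R" if "i \<le> 2" "j \<le> 3" for i j
      using v x that by simp
    then have "?e 0 0 \<in> carrier R" "?e 1 0 \<in> carrier R" "?e 2 0 \<in> carrier R"
      "?e 1 1 \<in> carrier R" "?e 2 1 \<in> carrier R" "?e 2 2 \<in> carrier R"
      by simp_all
    then have "(?e 0 0 \<ominus> ?e 1 0 \<oplus> ?e 2 0) \<ominus> (?e 0 0 \<ominus> ?e 1 1 \<oplus> ?e 2 1)
        \<oplus> (?e 1 0 \<ominus> ?e 1 1 \<oplus> ?e 2 2) \<ominus> (?e 2 0 \<ominus> ?e 2 1 \<oplus> ?e 2 2) = \<zero>"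
      by algebra
    ultimately show "\<delta> 2 (\<delta> 1 v) x = \<one>\<^bsub>C 3\<^esub> x"
      using x by simp
  qed (use v in auto)
qed

section \<open>Cup products in low degrees\<close>

lemma front_face_mem: "x \<in> S (p + q) \<Longrightarrow> front_face X p q x \<in> S p"
proof (induction q arbitrary: x)
  case (Suc q)
  then show ?case using face_closed[of "Suc (p + q)" "p + q" x] by simp
qed simp

lemma back_face_mem: "x \<in> S (p + q) \<Longrightarrow> back_face X p q x \<in> S q"
proof (induction p arbitrary: x)
  case (Suc p)
  then show ?case using face_closed[of 0 "p + q" x] by simp
qed simp

lemma cup_mem:
  assumes "u \<in> carrier (C p)" "v \<in> carrier (C q)"
  shows "cup X R p q u v \<in> carrier (C (p + q))"
  unfolding cup_def
  by (intro restrict_cochain m_closed cochain_closed[OF assms(1)] cochain_closed[OF assms(2)]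
      front_face_mem back_face_mem)

lemma cup_closed [simp]:
  "\<lbrakk>u \<in> carrier (C 0); v \<in> carrier (C 1)\<rbrakk> \<Longrightarrow> cup X R 0 1 u v \<in> carrier (C 1)"
  "\<lbrakk>u \<in> carrier (C 1); v \<in> carrier (C 0)\<rbrakk> \<Longrightarrow> cup X R 1 0 u v \<in> carrier (C 1)"
  "\<lbrakk>u \<in> carrier (C 1); v \<in> carrier (C 1)\<rbrakk> \<Longrightarrow> cup X R 1 1 u v \<in> carrier (C 2)"
  using cup_mem[of u 0 v 1] cup_mem[of u 1 v 0] cup_mem[of u 1 v 1] by simp_all

lemma cup_edge [simp]:
  assumes "e \<in> S 1"
  shows "cup X R 0 1 u v e = u (face X 1 1 e) \<otimes> v e"
    and "cup X R 1 0 u v e = u e \<otimes> v (face X 1 0 e)"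
  using assms by (simp_all add: cup_def One_nat_def)

lemma cup_triangle [simp]:
  assumes "x \<in> S 2"
  shows "cup X R 1 1 u v x = u (face X 2 2 x) \<otimes> v (face X 2 0 x)"
  using assms by (simp add: cup_def One_nat_def numeral_eq_Suc)


section \<open>Cohomology in degrees 1 and 2\<close>

lemma cocycle_iff: "a \<in> Z n \<longleftrightarrow> a \<in> carrier (C n) \<and> \<delta> n a = \<one>\<^bsub>C (Suc n)\<^esub>"
  by (auto simp: cocycles_def kernel_def)

lemma cocycle_cochain [simp]: "a \<in> Z n \<Longrightarrow> a \<in> carrier (C n)"
  by (simp add: cocycle_iff)

lemma cocycle_closed [simp]: "\<lbrakk>a \<in> Z n; x \<in> S n\<rbrakk> \<Longrightarrow> a x \<in> carrier R"
  by (rule cochain_closed[OF cocycle_cochain])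

lemma cocycles_subgroup: "subgroup (Z n) (C n)"
  unfolding cocycles_def by (rule \<delta>.subgroup_kernel)

lemma coboundaries_1: "B 1 = \<delta> 0 ` carrier (C 0)"
  and coboundaries_2: "B 2 = \<delta> 1 ` carrier (C 1)"
  by (simp_all add: coboundaries_def One_nat_def numeral_eq_Suc)

lemma coboundaries_subgroup:
  assumes "n \<in> {1, 2}"
  shows "subgroup (B n) (C n)"
  using assms \<delta>.img_is_subgroup[of 0] \<delta>.img_is_subgroup[of 1]
  by (auto simp: coboundaries_1 coboundaries_2 Suc_1 simp flip: One_nat_def)

lemma coboundaries_subset_cocycles:
  assumes "n \<in> {1, 2}"
  shows "B n \<subseteq> Z n"
proof -
  have [simp]: "Suc 1 = 2" "Suc 2 = 3" by simp_all
  show ?thesis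
    using assms coboundary_coboundary
    by (auto simp: coboundaries_1 coboundaries_2 cocycle_iff simp del: cocycle_cochain cocycle_closed)
qed

lemma coboundaries_normal:
  assumes "n \<in> {1, 2}"
  shows "B n \<lhd> C n\<lparr>carrier := Z n\<rparr>"
  by (rule C.normal_restrict_supergroup[OF cocycles_subgroup
        C.subgroup_imp_normal[OF coboundaries_subgroup[OF assms]]
        coboundaries_subset_cocycles[OF assms]])

lemma cohomology_group:
  assumes "n \<in> {1, 2}"
  shows "group (H n)"
  unfolding cohomology_def
  by (rule normal.factorgroup_is_group[OF coboundaries_normal[OF assms]])

lemma cohomology_class_hom:
  assumes "n \<in> {1, 2}"
  shows "cls n \<in> hom (C n\<lparr>carrier := Z n\<rparr>) (H n)"
proof -
  have "cls n = (\<lambda>a. B n #>\<^bsub>C n\<lparr>carrier := Z n\<rparr>\<^esub> a)"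
    by (simp add: fun_eq_iff cohomology_class_def r_coset_def)
  then show ?thesis
    using normal.r_coset_hom_Mod[OF coboundaries_normal[OF assms]] by (simp add: cohomology_def)
qed

lemma carrier_cohomology: "carrier (H n) = cls n ` Z n"
  by (auto simp: cohomology_def cohomology_class_def FactGroup_def RCOSETS_def r_coset_def)

lemma one_cohomology: "\<one>\<^bsub>H n\<^esub> = B n"
  by (simp add: cohomology_def FactGroup_def)

lemma cohomology_class_mem_iff: "c \<in> cls n a \<longleftrightarrow> (\<exists>b\<in>B n. c = b \<otimes>\<^bsub>C n\<^esub> a)"
  by (auto simp: cohomology_class_def r_coset_def)

lemma cohomology_class_self:
  assumes "n \<in> {1, 2}" "a \<in> carrier (C n)"
  shows "a \<in> cls n a"
  unfolding cohomology_class_def by (rule C.rcos_self[OF assms(2) coboundaries_subgroup[OF assms(1)]])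

lemma cohomology_class_eqI:
  assumes "n \<in> {1, 2}" "a \<in> carrier (C n)" "b \<in> B n" "c = b \<otimes>\<^bsub>C n\<^esub> a"
  shows "cls n c = cls n a"
  unfolding cohomology_class_def
  by (rule C.repr_independence[OF _ assms(2) coboundaries_subgroup[OF assms(1)], symmetric])
    (use assms cohomology_class_mem_iff cohomology_class_def in blast)

section \<open>The cup product on first cohomology\<close>

lemma cocycle_triangle:
  assumes "a \<in> Z 1" "x \<in> S 2"
  shows "a (face X 2 1 x) = a (face X 2 2 x) \<oplus> a (face X 2 0 x)"
proof -
  have "\<delta> 1 a x = \<zero>"
    using assms cocycle_iff[of a 1] by (simp add: Suc_1)
  then have "a (face X 2 0 x) \<ominus> a (face X 2 1 x) \<oplus> a (face X 2 2 x) = \<zero>"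
    using assms by (simp add: coboundary_triangle)
  moreover have "a (face X 2 0 x) \<in> carrier R" "a (face X 2 1 x) \<in> carrier R"
    "a (face X 2 2 x) \<in> carrier R"
    using assms by simp_all
  moreover from this have "a (face X 2 2 x) \<oplus> a (face X 2 0 x) =
      (a (face X 2 0 x) \<ominus> a (face X 2 1 x) \<oplus> a (face X 2 2 x)) \<oplus> a (face X 2 1 x)"
    by algebra
  ultimately show ?thesis
    by simp
qed

lemma cup_hom_right:
  assumes "a \<in> carrier (C 1)"
  shows "cup X R 1 1 a \<in> hom (C 1) (C 2)"
proof (rule homI)
  fix u v assume "u \<in> carrier (C 1)" "v \<in> carrier (C 1)"
  then show "cup X R 1 1 a (u \<otimes>\<^bsub>C 1\<^esub> v) = cup X R 1 1 a u \<otimes>\<^bsub>C 2\<^esub> cup X R 1 1 a v"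
    using assms by (intro cochain_eqI[of _ 2]) (simp_all add: r_distr)
qed (use assms in simp)

text \<open>
  The next two lemmas are the Leibniz rule for the product of a \<open>0\<close>-cochain and a \<open>1\<close>-cocycle.
\<close>

lemma cup_coboundary_left:
  assumes "b \<in> carrier (C 0)" "a \<in> Z 1"
  shows "\<delta> 1 (cup X R 0 1 b a) = cup X R 1 1 (\<delta> 0 b) a"
proof (rule cochain_eqI[of _ 2])
  fix x assume x: "x \<in> S 2"
  define r s b0 b1 where "r = a (face X 2 2 x)" and "s = a (face X 2 0 x)"
    and "b0 = b (face X 1 1 (face X 2 1 x))" and "b1 = b (face X 1 1 (face X 2 0 x))"
  have "r \<in> carrier R" "s \<in> carrier R" "b0 \<in> carrier R" "b1 \<in> carrier R"
    using assms x by (simp_all add: r_def s_def b0_def b1_def)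
  then have "b1 \<otimes> s \<ominus> b0 \<otimes> (r \<oplus> s) \<oplus> b0 \<otimes> r = (b1 \<ominus> b0) \<otimes> s"
    by algebra
  then show "\<delta> 1 (cup X R 0 1 b a) x = cup X R 1 1 (\<delta> 0 b) a x"
    using assms x
    by (simp add: coboundary_triangle coboundary_edge cocycle_triangle r_def s_def b0_def b1_def)
qed (use assms in auto)

lemma cup_coboundary_right:
  assumes "a \<in> Z 1" "b \<in> carrier (C 0)"
  shows "\<delta> 1 (cup X R 1 0 a b) = inv\<^bsub>C 2\<^esub> (cup X R 1 1 a (\<delta> 0 b))"
proof (rule cochain_eqI[of _ 2])
  fix x assume x: "x \<in> S 2"
  define r s b1 b2 where "r = a (face X 2 2 x)" and "s = a (face X 2 0 x)"
    and "b1 = b (face X 1 1 (face X 2 0 x))" and "b2 = b (face X 1 0 (face X 2 0 x))"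
  have "r \<in> carrier R" "s \<in> carrier R" "b1 \<in> carrier R" "b2 \<in> carrier R"
    using assms x by (simp_all add: r_def s_def b1_def b2_def)
  then have "s \<otimes> b2 \<ominus> (r \<oplus> s) \<otimes> b2 \<oplus> r \<otimes> b1 = \<ominus> (r \<otimes> (b2 \<ominus> b1))"
    by algebra
  then show "\<delta> 1 (cup X R 1 0 a b) x = (inv\<^bsub>C 2\<^esub> (cup X R 1 1 a (\<delta> 0 b))) x"
    using assms x
    by (simp add: coboundary_triangle coboundary_edge cocycle_triangle r_def s_def b1_def b2_def)
qed (use assms in auto)

lemma cup_cocycle:
  assumes "a \<in> Z 1" "b \<in> Z 1"
  shows "cup X R 1 1 a b \<in> Z 2"
proof -
  have "\<delta> 2 (cup X R 1 1 a b) = \<one>\<^bsub>C 3\<^esub>"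
  proof (rule cochain_eqI)
    fix x assume x: "x \<in> S 3"
    define a01 a12 b12 b23
      where "a01 = a (face X 2 2 (face X 3 2 x))" and "a12 = a (face X 2 2 (face X 3 0 x))"
        and "b12 = b (face X 2 2 (face X 3 0 x))" and "b23 = b (face X 2 0 (face X 3 0 x))"
    have "a01 \<in> carrier R" "a12 \<in> carrier R" "b12 \<in> carrier R" "b23 \<in> carrier R"
      using assms x by (simp_all add: a01_def a12_def b12_def b23_def)
    then have "a12 \<otimes> b23 \<ominus> (a01 \<oplus> a12) \<otimes> b23 \<oplus> a01 \<otimes> (b12 \<oplus> b23) \<ominus> a01 \<otimes> b12 = \<zero>"
      by algebra
    moreover have "a (face X 2 2 (face X 3 1 x)) = a01 \<oplus> a12"
      using cocycle_triangle[OF assms(1), of "face X 3 3 x"] x by (simp add: a01_def a12_def)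
    moreover have "b (face X 2 1 (face X 3 0 x)) = b12 \<oplus> b23"
      using cocycle_triangle[OF assms(2), of "face X 3 0 x"] x by (simp add: b12_def b23_def)
    ultimately show "\<delta> 2 (cup X R 1 1 a b) x = \<one>\<^bsub>C 3\<^esub> x"
      using assms x
      by (simp add: coboundary_tetrahedron flip: a01_def a12_def b12_def b23_def)
  qed (use assms in auto)
  then show ?thesis
    using assms cocycle_iff[of _ 2] by simp
qed

text \<open>
  The class of a cup product does not depend on the representatives of the factors, so the union
  that defines the product of two cohomology classes is a single class.
\<close>

lemma cohomology_class_cup:
  assumes "a \<in> Z 1" "b \<in> Z 1" "a' \<in> cls 1 a" "b' \<in> cls 1 b"
  shows "cls 2 (cup X R 1 1 a' b') = cls 2 (cup X R 1 1 a b)"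
proof -
  obtain s where s: "s \<in> carrier (C 0)" "a' = \<delta> 0 s \<otimes>\<^bsub>C 1\<^esub> a"
    using assms(3) by (auto simp: cohomology_class_mem_iff coboundaries_1)
  obtain t where t: "t \<in> carrier (C 0)" "b' = \<delta> 0 t \<otimes>\<^bsub>C 1\<^esub> b"
    using assms(4) by (auto simp: cohomology_class_mem_iff coboundaries_1)
  have b': "b' \<in> Z 1"
    using t assms(2) coboundaries_subset_cocycles[of 1] subgroup.m_closed[OF cocycles_subgroup]
    by (auto simp: coboundaries_1)
  \<comment> \<open>\<open>(a + \<delta>s) \<union> b' - a \<union> b = \<delta>s \<union> b' + a \<union> \<delta>t = \<delta>(s \<union> b' - a \<union> t)\<close>\<close>
  define w where "w = cup X R 0 1 s b' \<otimes>\<^bsub>C 1\<^esub> inv\<^bsub>C 1\<^esub> (cup X R 1 0 a t)"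
  have w: "w \<in> carrier (C 1)"
    using s t b' assms by (simp add: w_def)
  have "\<delta> 1 w = \<delta> 1 (cup X R 0 1 s b') \<otimes>\<^bsub>C 2\<^esub> inv\<^bsub>C 2\<^esub> \<delta> 1 (cup X R 1 0 a t)"
    using s(1) t(1) b' assms by (simp add: w_def)
  also have "\<dots> = cup X R 1 1 (\<delta> 0 s) b' \<otimes>\<^bsub>C 2\<^esub> cup X R 1 1 a (\<delta> 0 t)"
    using s t b' assms by (simp add: cup_coboundary_left cup_coboundary_right)
  finally have "cup X R 1 1 a' b' = \<delta> 1 w \<otimes>\<^bsub>C 2\<^esub> cup X R 1 1 a b"
    using s t b' assms
    by (intro cochain_eqI[of _ 2]) (simp_all add: coboundary_edge l_distr r_distr a_ac)
  then show ?thesis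
    using w assms by (intro cohomology_class_eqI[of 2 _ "\<delta> 1 w"]) (auto simp: coboundaries_2)
qed

lemma cohomology_cup_class:
  assumes "a \<in> Z 1" "b \<in> Z 1"
  shows "cohomology_cup X R 1 1 (cls 1 a) (cls 1 b) = cls 2 (cup X R 1 1 a b)"
proof -
  have "cls 1 a \<noteq> {}" "cls 1 b \<noteq> {}"
    using assms cohomology_class_self[of 1 a] cohomology_class_self[of 1 b] by auto
  then show ?thesis
    unfolding cohomology_cup_def
    using cohomology_class_cup[OF assms] by auto
qed

end

section \<open>Differences of elements of a coset\<close>

lemma indeterminacy_rcoset:
  fixes G :: "'g monoid" (structure)
  assumes "group G" "subgroup K G" "g \<in> carrier G"
  shows "indeterminacy G (K #> g) = K"
proof -
  interpret group G by (rule assms)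
  interpret K: subgroup K G by (rule assms)
  have diff: "(h \<otimes> g) \<otimes> inv (k \<otimes> g) = h \<otimes> inv k" if "h \<in> K" "k \<in> K" for h k
  proof -
    have "inv (k \<otimes> g) = inv g \<otimes> inv k"
      using that assms(3) by (simp add: inv_mult_group)
    moreover have "(h \<otimes> g) \<otimes> (inv g \<otimes> inv k) = h \<otimes> (g \<otimes> (inv g \<otimes> inv k))"
      using that assms(3) by (intro m_assoc) simp_all
    moreover have "g \<otimes> (inv g \<otimes> inv k) = inv k"
      using that assms(3) by (metis K.mem_carrier inv_closed l_one m_assoc r_inv)
    ultimately show ?thesis
      by simp
  qed
  show ?thesis
  proof
    show "indeterminacy G (K #> g) \<subseteq> K"
      by (auto simp: indeterminacy_def r_coset_def diff)
    show "K \<subseteq> indeterminacy G (K #> g)"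
    proof
      fix h assume h: "h \<in> K"
      then have "h = (h \<otimes> g) \<otimes> inv (\<one> \<otimes> g)"
        using diff[OF h K.one_closed] by simp
      moreover have "h \<otimes> g \<in> K #> g" "\<one> \<otimes> g \<in> K #> g"
        using h K.one_closed unfolding r_coset_def by blast+
      ultimately show "h \<in> indeterminacy G (K #> g)"
        unfolding indeterminacy_def by blast
    qed
  qed
qed

section \<open>The cochain of a restricted Massey product\<close>

locale halving_cochain_complex = cochain_complex X R + halving_ring R
  for X :: "'a delta_data" and R :: "'r ring" (structure)
begin

abbreviation "\<zeta> \<equiv> zeta2 X R"
abbreviation "\<gamma> \<equiv> massey_cochain X R"

lemma zeta2_apply [simp]: "e \<in> S 1 \<Longrightarrow> \<zeta> a e = binom2 (a e)"
  by (simp add: zeta2_def binom2_def)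

lemma zeta2_closed [simp]: "a \<in> carrier (C 1) \<Longrightarrow> \<zeta> a \<in> carrier (C 1)"
  unfolding zeta2_def
  by (rule restrict_cochain) (simp add: binom2_closed flip: binom2_def)

lemma massey_cochain_closed [simp]:
  "\<lbrakk>a1 \<in> carrier (C 1); a2 \<in> carrier (C 1); a12 \<in> carrier (C 1)\<rbrakk> \<Longrightarrow> \<gamma> a1 a2 a12 \<in> carrier (C 2)"
  by (simp add: massey_cochain_def)

lemma massey_cochain_apply [simp]:
  assumes "a1 \<in> carrier (C 1)" "a2 \<in> carrier (C 1)" "a12 \<in> carrier (C 1)" "x \<in> S 2"
  shows "\<gamma> a1 a2 a12 x =
    a1 (face X 2 2 x) \<otimes> a12 (face X 2 0 x) \<ominus> binom2 (a1 (face X 2 2 x)) \<otimes> a2 (face X 2 0 x)"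
  using assms by (simp add: massey_cochain_def minus_eq)

text \<open>
  The equation \<open>\<delta>a\<^sub>1\<^sub>2 = a\<^sub>1 \<union> a\<^sub>2\<close> on a triangle, solved for the value of \<open>a\<^sub>1\<^sub>2\<close> on its long edge.
\<close>

lemma defining_system_triangle:
  assumes "a1 \<in> carrier (C 1)" "a2 \<in> carrier (C 1)" "a12 \<in> carrier (C 1)"
    and "\<delta> 1 a12 = cup X R 1 1 a1 a2" "x \<in> S 2"
  shows "a12 (face X 2 1 x) =
    a12 (face X 2 0 x) \<oplus> a12 (face X 2 2 x) \<ominus> a1 (face X 2 2 x) \<otimes> a2 (face X 2 0 x)"
proof -
  let ?p = "a1 (face X 2 2 x) \<otimes> a2 (face X 2 0 x)"
  have "a12 (face X 2 0 x) \<ominus> a12 (face X 2 1 x) \<oplus> a12 (face X 2 2 x) = ?p"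
    using assms coboundary_triangle[of a12 x] by simp
  moreover have "a12 (face X 2 0 x) \<in> carrier R" "a12 (face X 2 1 x) \<in> carrier R"
    "a12 (face X 2 2 x) \<in> carrier R"
    using assms by simp_all
  moreover from this have "a12 (face X 2 0 x) \<oplus> a12 (face X 2 2 x)
      \<ominus> (a12 (face X 2 0 x) \<ominus> a12 (face X 2 1 x) \<oplus> a12 (face X 2 2 x)) = a12 (face X 2 1 x)"
    by algebra
  ultimately show ?thesis
    by simp
qed

lemma massey_cochain_cocycle:
  assumes a1: "a1 \<in> Z 1" and a2: "a2 \<in> Z 1"
    and a12: "a12 \<in> carrier (C 1)" "\<delta> 1 a12 = cup X R 1 1 a1 a2"
  shows "\<gamma> a1 a2 a12 \<in> Z 2"
proof -
  have "\<delta> 2 (\<gamma> a1 a2 a12) = \<one>\<^bsub>C 3\<^esub>"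
  proof (rule cochain_eqI)
    fix x assume x: "x \<in> S 3"
    define p q r s m n h k
      where "p = a1 (face X 2 2 (face X 3 2 x))" and "q = a1 (face X 2 2 (face X 3 0 x))"
        and "r = a2 (face X 2 2 (face X 3 0 x))" and "s = a2 (face X 2 0 (face X 3 0 x))"
        and "m = a12 (face X 2 2 (face X 3 0 x))" and "n = a12 (face X 2 0 (face X 3 0 x))"
        and "h = binom2 p" and "k = binom2 q"
    have carr: "p \<in> carrier R" "q \<in> carrier R" "r \<in> carrier R" "s \<in> carrier R"
      "m \<in> carrier R" "n \<in> carrier R" "h \<in> carrier R" "k \<in> carrier R"
      using a1 a2 a12 x
      by (simp_all add: p_def q_def r_def s_def m_def n_def h_def k_def binom2_closed)
    have "(q \<otimes> n \<ominus> k \<otimes> s) \<ominus> ((p \<oplus> q) \<otimes> n \<ominus> (h \<oplus> k \<oplus> p \<otimes> q) \<otimes> s)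
        \<oplus> (p \<otimes> (n \<oplus> m \<ominus> q \<otimes> s) \<ominus> h \<otimes> (r \<oplus> s)) \<ominus> (p \<otimes> m \<ominus> h \<otimes> r) = \<zero>"
      using carr by algebra
    moreover have "a1 (face X 2 2 (face X 3 1 x)) = p \<oplus> q"
      using cocycle_triangle[OF a1, of "face X 3 3 x"] x by (simp add: p_def q_def)
    moreover have "a2 (face X 2 1 (face X 3 0 x)) = r \<oplus> s"
      using cocycle_triangle[OF a2, of "face X 3 0 x"] x by (simp add: r_def s_def)
    moreover have "a12 (face X 2 1 (face X 3 0 x)) = n \<oplus> m \<ominus> q \<otimes> s"
      using defining_system_triangle[of a1 a2 a12 "face X 3 0 x"] a1 a2 a12 x
      by (simp add: n_def m_def q_def s_def)
    moreover have "binom2 (p \<oplus> q) = h \<oplus> k \<oplus> p \<otimes> q"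
      using carr by (simp add: binom2_add h_def k_def)
    ultimately show "\<delta> 2 (\<gamma> a1 a2 a12) x = \<one>\<^bsub>C 3\<^esub> x"
      using a1 a2 a12 x
      by (simp add: coboundary_tetrahedron
          flip: p_def q_def r_def s_def m_def n_def h_def k_def)
  qed (use a1 a2 a12 in auto)
  then show ?thesis
    using a1 a2 a12 cocycle_iff[of _ 2] by simp
qed

text \<open>
  Independence of the representative \<open>a\<^sub>1\<close>. With \<open>\<cdot>\<close> for the pointwise product,
  \<open>\<zeta>\<^sub>2(a\<^sub>1 + \<delta>b) = \<zeta>\<^sub>2(a\<^sub>1) + \<zeta>\<^sub>2(\<delta>b) + a\<^sub>1 \<cdot> \<delta>b\<close> and \<open>a\<^sub>1 \<cdot> \<delta>b = a\<^sub>1 \<union> b - b \<union> a\<^sub>1\<close>. After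
  subtracting \<open>\<delta>(b \<union> a\<^sub>1\<^sub>2)\<close>, the change of \<open>\<gamma>\<close> is thus \<open>(\<delta>b \<union> b - \<zeta>\<^sub>2(\<delta>b)) \<union> a\<^sub>2\<close>. On an edge
  from \<open>v\<close> to \<open>v'\<close>, with \<open>b(v) = s\<close> and \<open>b(v') = t\<close>, the first factor is
  \<open>(t - s) t - (t - s)(t - s - 1)/2 = t (t + 1)/2 - s (s + 1)/2\<close>.
\<close>

lemma massey_cochain_change_first:
  assumes a1: "a1 \<in> Z 1" and a2: "a2 \<in> Z 1" and b: "b \<in> carrier (C 0)"
    and a12: "a12 \<in> carrier (C 1)" "\<delta> 1 a12 = cup X R 1 1 a1 a2"
  shows "\<exists>u\<in>carrier (C 1). \<gamma> (\<delta> 0 b \<otimes>\<^bsub>C 1\<^esub> a1) a2 (cup X R 0 1 b a2 \<otimes>\<^bsub>C 1\<^esub> a12) =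
      \<delta> 1 u \<otimes>\<^bsub>C 2\<^esub> \<gamma> a1 a2 a12"
proof
  \<comment> \<open>\<open>y\<^sup>2 - y (y - 1)/2 = y (y + 1)/2\<close>\<close>
  define w where "w = (\<lambda>v\<in>S 0. b v \<otimes> b v \<ominus> binom2 (b v))"
  define u where "u = cup X R 0 1 b a12 \<otimes>\<^bsub>C 1\<^esub> cup X R 0 1 w a2"
  have w: "w \<in> carrier (C 0)"
    unfolding w_def by (rule restrict_cochain) (use b binom2_closed in simp)
  show u: "u \<in> carrier (C 1)"
    using w a2 b a12 by (simp add: u_def)
  show "\<gamma> (\<delta> 0 b \<otimes>\<^bsub>C 1\<^esub> a1) a2 (cup X R 0 1 b a2 \<otimes>\<^bsub>C 1\<^esub> a12) = \<delta> 1 u \<otimes>\<^bsub>C 2\<^esub> \<gamma> a1 a2 a12"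
  proof (rule cochain_eqI[of _ 2])
    fix x assume x: "x \<in> S 2"
    define p r s m n b0 b1 hp hd h0
      where "p = a1 (face X 2 2 x)" and "r = a2 (face X 2 2 x)" and "s = a2 (face X 2 0 x)"
        and "m = a12 (face X 2 2 x)" and "n = a12 (face X 2 0 x)"
        and "b0 = b (face X 1 1 (face X 2 1 x))" and "b1 = b (face X 1 1 (face X 2 0 x))"
        and "hp = binom2 p" and "hd = binom2 (b1 \<ominus> b0)" and "h0 = binom2 b0"
    have carr: "p \<in> carrier R" "r \<in> carrier R" "s \<in> carrier R" "m \<in> carrier R" "n \<in> carrier R"
      "b0 \<in> carrier R" "b1 \<in> carrier R" "hp \<in> carrier R" "hd \<in> carrier R" "h0 \<in> carrier R"
      using a1 a2 a12 b x by (simp_all add: p_def r_def s_def m_def n_def b0_def b1_def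
          hp_def hd_def h0_def binom2_closed)
    have l: "a12 (face X 2 1 x) = n \<oplus> m \<ominus> p \<otimes> s"
      using defining_system_triangle[of a1 a2 a12 x] a1 a2 a12 x
      by (simp add: n_def m_def p_def s_def)
    have hpd: "binom2 ((b1 \<ominus> b0) \<oplus> p) = hd \<oplus> hp \<oplus> (b1 \<ominus> b0) \<otimes> p"
      using carr by (simp add: binom2_add hd_def hp_def)
    have "b1 = (b1 \<ominus> b0) \<oplus> b0"
      using carr by algebra
    then have "binom2 b1 = binom2 ((b1 \<ominus> b0) \<oplus> b0)"
      by simp
    also have "\<dots> = hd \<oplus> h0 \<oplus> (b1 \<ominus> b0) \<otimes> b0"
      using carr by (simp add: binom2_add hd_def h0_def)
    finally have h1: "binom2 b1 = hd \<oplus> h0 \<oplus> (b1 \<ominus> b0) \<otimes> b0" .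
    have "((b1 \<ominus> b0) \<oplus> p) \<otimes> (b1 \<otimes> s \<oplus> n) \<ominus> (hd \<oplus> hp \<oplus> (b1 \<ominus> b0) \<otimes> p) \<otimes> s =
        ((b1 \<otimes> n \<oplus> (b1 \<otimes> b1 \<ominus> (hd \<oplus> h0 \<oplus> (b1 \<ominus> b0) \<otimes> b0)) \<otimes> s)
          \<ominus> (b0 \<otimes> (n \<oplus> m \<ominus> p \<otimes> s) \<oplus> (b0 \<otimes> b0 \<ominus> h0) \<otimes> (r \<oplus> s))
          \<oplus> (b0 \<otimes> m \<oplus> (b0 \<otimes> b0 \<ominus> h0) \<otimes> r))
        \<oplus> (p \<otimes> n \<ominus> hp \<otimes> s)"
      using carr by algebra
    moreover have "\<delta> 1 u x =
        (b1 \<otimes> n \<oplus> (b1 \<otimes> b1 \<ominus> binom2 b1) \<otimes> s)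
          \<ominus> (b0 \<otimes> a12 (face X 2 1 x) \<oplus> (b0 \<otimes> b0 \<ominus> h0) \<otimes> (r \<oplus> s))
          \<oplus> (b0 \<otimes> m \<oplus> (b0 \<otimes> b0 \<ominus> h0) \<otimes> r)"
      using u x cocycle_triangle[OF a2 x]
      by (simp add: coboundary_triangle) (simp add: u_def w_def r_def s_def m_def n_def b0_def b1_def h0_def)
    ultimately show "\<gamma> (\<delta> 0 b \<otimes>\<^bsub>C 1\<^esub> a1) a2 (cup X R 0 1 b a2 \<otimes>\<^bsub>C 1\<^esub> a12) x =
        (\<delta> 1 u \<otimes>\<^bsub>C 2\<^esub> \<gamma> a1 a2 a12) x"
      using a1 a2 a12 b x
      by (simp add: coboundary_edge l hpd h1 flip: p_def r_def s_def m_def n_def b0_def b1_def hp_def)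
  qed (use a1 a2 a12 b u in auto)
qed

text \<open>
  Independence of the representative \<open>a\<^sub>2\<close>: since \<open>\<delta>\<zeta>\<^sub>2(a\<^sub>1) = - a\<^sub>1 \<union> a\<^sub>1\<close>, the change of \<open>\<gamma>\<close> is
  \<open>- a\<^sub>1 \<union> a\<^sub>1 \<union> c - \<zeta>\<^sub>2(a\<^sub>1) \<union> \<delta>c = \<delta>(\<zeta>\<^sub>2(a\<^sub>1) \<union> c)\<close>.
\<close>

lemma massey_cochain_change_second:
  assumes a1: "a1 \<in> Z 1" and a2: "a2 \<in> Z 1" and c: "c \<in> carrier (C 0)"
    and a12: "a12 \<in> carrier (C 1)"
  shows "\<gamma> a1 (\<delta> 0 c \<otimes>\<^bsub>C 1\<^esub> a2) (inv\<^bsub>C 1\<^esub> (cup X R 1 0 a1 c) \<otimes>\<^bsub>C 1\<^esub> a12) =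
      \<delta> 1 (cup X R 1 0 (\<zeta> a1) c) \<otimes>\<^bsub>C 2\<^esub> \<gamma> a1 a2 a12"
proof (rule cochain_eqI[of _ 2])
  fix x assume x: "x \<in> S 2"
  define p q s n c1 c2 hp hq
    where "p = a1 (face X 2 2 x)" and "q = a1 (face X 2 0 x)" and "s = a2 (face X 2 0 x)"
      and "n = a12 (face X 2 0 x)" and "c1 = c (face X 1 1 (face X 2 0 x))"
      and "c2 = c (face X 1 0 (face X 2 0 x))" and "hp = binom2 p" and "hq = binom2 q"
  have carr: "p \<in> carrier R" "q \<in> carrier R" "s \<in> carrier R" "n \<in> carrier R"
    "c1 \<in> carrier R" "c2 \<in> carrier R" "hp \<in> carrier R" "hq \<in> carrier R"
    using a1 a2 a12 c x by (simp_all add: p_def q_def s_def n_def c1_def c2_def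
        hp_def hq_def binom2_closed)
  have "binom2 (p \<oplus> q) = hp \<oplus> hq \<oplus> p \<otimes> q"
    using carr by (simp add: binom2_add hp_def hq_def)
  moreover have "a1 (face X 2 1 x) = p \<oplus> q"
    using cocycle_triangle[OF a1 x] by (simp add: p_def q_def)
  moreover have "p \<otimes> (\<ominus> (q \<otimes> c2) \<oplus> n) \<ominus> hp \<otimes> ((c2 \<ominus> c1) \<oplus> s) =
      (hq \<otimes> c2 \<ominus> (hp \<oplus> hq \<oplus> p \<otimes> q) \<otimes> c2 \<oplus> hp \<otimes> c1) \<oplus> (p \<otimes> n \<ominus> hp \<otimes> s)"
    using carr by algebra
  ultimately show "\<gamma> a1 (\<delta> 0 c \<otimes>\<^bsub>C 1\<^esub> a2) (inv\<^bsub>C 1\<^esub> (cup X R 1 0 a1 c) \<otimes>\<^bsub>C 1\<^esub> a12) x =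
      (\<delta> 1 (cup X R 1 0 (\<zeta> a1) c) \<otimes>\<^bsub>C 2\<^esub> \<gamma> a1 a2 a12) x"
    using a1 a2 a12 c x
    by (simp add: coboundary_triangle coboundary_edge
        flip: p_def q_def s_def n_def c1_def c2_def hp_def hq_def)
qed (use a1 a2 a12 c in auto)

lemma massey_cochain_add_right:
  assumes a1: "a1 \<in> carrier (C 1)" and a2: "a2 \<in> carrier (C 1)"
    and z: "z \<in> carrier (C 1)" and a12: "a12 \<in> carrier (C 1)"
  shows "\<gamma> a1 a2 (z \<otimes>\<^bsub>C 1\<^esub> a12) = cup X R 1 1 a1 z \<otimes>\<^bsub>C 2\<^esub> \<gamma> a1 a2 a12"
  using assms by (intro cochain_eqI[of _ 2]) (simp_all add: r_distr minus_eq a_assoc binom2_closed)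


section \<open>The restricted Massey product as a coset\<close>

lemma massey_cochain_change:
  assumes "a1 \<in> Z 1" "a2 \<in> Z 1" "a12 \<in> carrier (C 1)" "\<delta> 1 a12 = cup X R 1 1 a1 a2"
    and "a1' \<in> Z 1" "a2' \<in> Z 1" "a12' \<in> carrier (C 1)" "\<delta> 1 a12' = cup X R 1 1 a1' a2'"
    and "cls 1 a1' = cls 1 a1" "cls 1 a2' = cls 1 a2"
  obtains z where "z \<in> Z 1"
    "cls 2 (\<gamma> a1' a2' a12') = cls 2 (cup X R 1 1 a1 z) \<otimes>\<^bsub>H 2\<^esub> cls 2 (\<gamma> a1 a2 a12)"
proof -
  have mem: "a1' \<in> cls 1 a1" "a2' \<in> cls 1 a2"
    using assms cohomology_class_self[of 1 a1'] cohomology_class_self[of 1 a2'] by auto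
  obtain b where b: "b \<in> carrier (C 0)" "a1' = \<delta> 0 b \<otimes>\<^bsub>C 1\<^esub> a1"
    using mem(1) by (auto simp: cohomology_class_mem_iff coboundaries_1)
  obtain c where c: "c \<in> carrier (C 0)" "a2' = \<delta> 0 c \<otimes>\<^bsub>C 1\<^esub> a2"
    using mem(2) by (auto simp: cohomology_class_mem_iff coboundaries_1)
  \<comment> \<open>\<open>e\<close> and \<open>f\<close> are \<open>a\<^sub>1\<^sub>2\<close> corrected for the change of \<open>a\<^sub>1\<close>, and then also for that of \<open>a\<^sub>2\<close>.\<close>
  define e where "e = cup X R 0 1 b a2 \<otimes>\<^bsub>C 1\<^esub> a12"
  define f where "f = inv\<^bsub>C 1\<^esub> (cup X R 1 0 a1' c) \<otimes>\<^bsub>C 1\<^esub> e"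
  define z where "z = a12' \<otimes>\<^bsub>C 1\<^esub> inv\<^bsub>C 1\<^esub> f"
  have e: "e \<in> carrier (C 1)" and f: "f \<in> carrier (C 1)" and z: "z \<in> carrier (C 1)"
    using assms(1-8) b(1) c(1) by (simp_all add: e_def f_def z_def)
  have \<delta>e: "\<delta> 1 e = cup X R 1 1 a1' a2"
  proof -
    have "\<delta> 1 e = cup X R 1 1 (\<delta> 0 b) a2 \<otimes>\<^bsub>C 2\<^esub> cup X R 1 1 a1 a2"
      using assms(1-4) b(1) by (simp add: e_def cup_coboundary_left)
    also have "\<dots> = cup X R 1 1 a1' a2"
      unfolding b(2) using assms(1,2) b(1)
      by (intro cochain_eqI[of _ 2]) (simp_all add: coboundary_edge l_distr)
    finally show ?thesis .
  qed
  have "\<delta> 1 f = cup X R 1 1 a1' (\<delta> 0 c) \<otimes>\<^bsub>C 2\<^esub> cup X R 1 1 a1' a2"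
    using assms(2,5) c(1) e by (simp add: f_def \<delta>e cup_coboundary_right)
  also have "\<dots> = cup X R 1 1 a1' a2'"
    unfolding c(2) using assms(2,5) c(1)
    by (intro cochain_eqI[of _ 2]) (simp_all add: coboundary_edge r_distr)
  finally have \<delta>f: "\<delta> 1 f = cup X R 1 1 a1' a2'" .
  have z_cocycle: "z \<in> Z 1"
    using z f assms(5-8) cocycle_iff[of z 1] by (simp add: z_def \<delta>f Suc_1)
  obtain u where u: "u \<in> carrier (C 1)" "\<gamma> a1' a2 e = \<delta> 1 u \<otimes>\<^bsub>C 2\<^esub> \<gamma> a1 a2 a12"
    using massey_cochain_change_first[OF assms(1,2) b(1) assms(3,4)] by (auto simp: b(2) e_def)
  have "cls 2 (\<gamma> a1' a2' f) = cls 2 (\<gamma> a1' a2 e)"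
    using massey_cochain_change_second[OF assms(5,2) c(1) e] assms(2,5) c(1) e
    by (intro cohomology_class_eqI[of 2 _ "\<delta> 1 (cup X R 1 0 (\<zeta> a1') c)"])
      (auto simp: f_def c(2) coboundaries_2)
  also have "\<dots> = cls 2 (\<gamma> a1 a2 a12)"
    using u assms(1-3)
    by (intro cohomology_class_eqI[of 2 _ "\<delta> 1 u"]) (auto simp: coboundaries_2)
  finally have *: "cls 2 (\<gamma> a1' a2' f) = cls 2 (\<gamma> a1 a2 a12)" .
  have "a12' = z \<otimes>\<^bsub>C 1\<^esub> f"
    using assms(7) f by (simp add: z_def C.m_assoc)
  then have "\<gamma> a1' a2' a12' = cup X R 1 1 a1' z \<otimes>\<^bsub>C 2\<^esub> \<gamma> a1' a2' f"
    using massey_cochain_add_right[of a1' a2' z f] assms(5,6) z f by simp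
  then have "cls 2 (\<gamma> a1' a2' a12') = cls 2 (cup X R 1 1 a1' z) \<otimes>\<^bsub>H 2\<^esub> cls 2 (\<gamma> a1' a2' f)"
    using hom_mult[OF cohomology_class_hom[of 2], of "cup X R 1 1 a1' z" "\<gamma> a1' a2' f"]
      cup_cocycle[OF assms(5) z_cocycle] massey_cochain_cocycle[OF assms(5,6) f \<delta>f] by simp
  also have "cls 2 (cup X R 1 1 a1' z) = cls 2 (cup X R 1 1 a1 z)"
    using cohomology_class_cup[OF assms(1) z_cocycle mem(1)] cohomology_class_self[of 1 z] z by simp
  finally show thesis
    using that[OF z_cocycle] by (simp add: *)
qed

lemma restricted_massey_rcoset:
  assumes a1: "a1 \<in> Z 1" and a2: "a2 \<in> Z 1"
    and a12: "a12 \<in> carrier (C 1)" "\<delta> 1 a12 = cup X R 1 1 a1 a2"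
  shows "restricted_massey X R (cls 1 a1) (cls 1 a2) =
    cohomology_cup X R 1 1 (cls 1 a1) ` carrier (H 1) #>\<^bsub>H 2\<^esub> cls 2 (\<gamma> a1 a2 a12)"
    (is "?M = ?K #>\<^bsub>H 2\<^esub> ?g")
proof
  have K: "?K = (\<lambda>z. cls 2 (cup X R 1 1 a1 z)) ` Z 1"
    using a1 by (auto simp: carrier_cohomology cohomology_cup_class image_image)
  show "?M \<subseteq> ?K #>\<^bsub>H 2\<^esub> ?g"
  proof
    fix m assume "m \<in> ?M"
    then obtain a1' a2' a12' where m: "m = cls 2 (\<gamma> a1' a2' a12')"
      and *: "a1' \<in> Z 1" "a2' \<in> Z 1" "a12' \<in> carrier (C 1)" "\<delta> 1 a12' = cup X R 1 1 a1' a2'"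
        "cls 1 a1' = cls 1 a1" "cls 1 a2' = cls 1 a2"
      by (auto simp: restricted_massey_def)
    obtain z where "z \<in> Z 1"
      "cls 2 (\<gamma> a1' a2' a12') = cls 2 (cup X R 1 1 a1 z) \<otimes>\<^bsub>H 2\<^esub> ?g"
      using massey_cochain_change[OF a1 a2 a12 *] .
    then show "m \<in> ?K #>\<^bsub>H 2\<^esub> ?g"
      unfolding K m r_coset_def by blast
  qed
  show "?K #>\<^bsub>H 2\<^esub> ?g \<subseteq> ?M"
  proof
    fix m assume "m \<in> ?K #>\<^bsub>H 2\<^esub> ?g"
    then obtain z where z: "z \<in> Z 1" and m: "m = cls 2 (cup X R 1 1 a1 z) \<otimes>\<^bsub>H 2\<^esub> ?g"
      unfolding K r_coset_def by blast
    let ?y = "z \<otimes>\<^bsub>C 1\<^esub> a12"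
    have "m = cls 2 (cup X R 1 1 a1 z \<otimes>\<^bsub>C 2\<^esub> \<gamma> a1 a2 a12)"
      unfolding m using hom_mult[OF cohomology_class_hom[of 2], of "cup X R 1 1 a1 z" "\<gamma> a1 a2 a12"]
        cup_cocycle[OF a1 z] massey_cochain_cocycle[OF a1 a2 a12] by simp
    then have "m = cls 2 (\<gamma> a1 a2 ?y)"
      using a1 a2 a12 z by (simp add: massey_cochain_add_right)
    moreover have "\<delta> 1 ?y = cup X R 1 1 a1 a2"
      using a1 a2 a12 z cocycle_iff[of z 1] by (simp add: Suc_1)
    moreover have "?y \<in> carrier (C 1)"
      using z a12 by simp
    ultimately show "m \<in> ?M"
      unfolding restricted_massey_def using a1 a2 by blast
  qed
qed

lemma cup_class_image_subgroup:
  assumes a: "a \<in> Z 1"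
  shows "subgroup (cohomology_cup X R 1 1 (cls 1 a) ` carrier (H 1)) (H 2)"
proof -
  have "cls 2 \<circ> cup X R 1 1 a \<in> hom (C 1\<lparr>carrier := Z 1\<rparr>) (H 2)"
  proof (rule hom_compose)
    show "cup X R 1 1 a \<in> hom (C 1\<lparr>carrier := Z 1\<rparr>) (C 2\<lparr>carrier := Z 2\<rparr>)"
      using a cup_cocycle hom_mult[OF cup_hom_right[of a]] by (intro homI) simp_all
    show "cls 2 \<in> hom (C 2\<lparr>carrier := Z 2\<rparr>) (H 2)"
      by (rule cohomology_class_hom) simp
  qed
  then interpret group_hom "C 1\<lparr>carrier := Z 1\<rparr>" "H 2" "cls 2 \<circ> cup X R 1 1 a"
    using C.subgroup_imp_group[OF cocycles_subgroup] cohomology_group[of 2]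
    by (simp add: group_hom_def group_hom_axioms_def)
  have "cohomology_cup X R 1 1 (cls 1 a) ` carrier (H 1) = (cls 2 \<circ> cup X R 1 1 a) ` Z 1"
    using a by (auto simp: carrier_cohomology cohomology_cup_class image_image)
  then show ?thesis
    using img_is_subgroup by simp
qed

theorem restricted_massey_indeterminacy:
  assumes "u1 \<in> carrier (H 1)" "u2 \<in> carrier (H 1)"
    and "cohomology_cup X R 1 1 u1 u2 = \<one>\<^bsub>H 2\<^esub>"
  shows "indeterminacy (H 2) (restricted_massey X R u1 u2) = cohomology_cup X R 1 1 u1 ` carrier (H 1)"
    and "restricted_massey X R u1 u2 \<in> rcosets\<^bsub>H 2\<^esub> (cohomology_cup X R 1 1 u1 ` carrier (H 1))"
proof -
  obtain a1 a2 where a: "a1 \<in> Z 1" "u1 = cls 1 a1" "a2 \<in> Z 1" "u2 = cls 1 a2"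
    using assms(1,2) by (auto simp: carrier_cohomology)
  have "cup X R 1 1 a1 a2 \<in> B 2"
    using assms(3) a cohomology_class_self[of 2 "cup X R 1 1 a1 a2"]
    by (simp add: cohomology_cup_class one_cohomology)
  then obtain a12 where a12: "a12 \<in> carrier (C 1)" "\<delta> 1 a12 = cup X R 1 1 a1 a2"
    by (auto simp: coboundaries_2)
  have M: "restricted_massey X R u1 u2 =
      cohomology_cup X R 1 1 u1 ` carrier (H 1) #>\<^bsub>H 2\<^esub> cls 2 (\<gamma> a1 a2 a12)"
    unfolding a by (rule restricted_massey_rcoset[OF a(1,3) a12])
  have g: "cls 2 (\<gamma> a1 a2 a12) \<in> carrier (H 2)"
    using massey_cochain_cocycle[OF a(1,3) a12] by (auto simp: carrier_cohomology)
  have K: "subgroup (cohomology_cup X R 1 1 u1 ` carrier (H 1)) (H 2)"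
    unfolding a by (rule cup_class_image_subgroup[OF a(1)])
  show "indeterminacy (H 2) (restricted_massey X R u1 u2) = cohomology_cup X R 1 1 u1 ` carrier (H 1)"
    unfolding M by (rule indeterminacy_rcoset[OF _ K g]) (simp add: cohomology_group)
  show "restricted_massey X R u1 u2 \<in> rcosets\<^bsub>H 2\<^esub> (cohomology_cup X R 1 1 u1 ` carrier (H 1))"
    unfolding M RCOSETS_def using g by blast
qed

end

theorem lemma9p9:
  fixes X :: "'a delta_data" and R :: "int ring" and u1 u2 :: "('a \<Rightarrow> int) set"
  assumes "R = \<Z> \<or> (\<exists>p::int. prime p \<and> p \<ge> 3 \<and> R = residue_ring p)"
    and "delta_complex X"
    and "u1 \<in> carrier (cohomology X R 1)"
    and "u2 \<in> carrier (cohomology X R 1)"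
    and "cohomology_cup X R 1 1 u1 u2 = \<one>\<^bsub>cohomology X R 2\<^esub>"
  shows "indeterminacy (cohomology X R 2) (restricted_massey X R u1 u2) =
           cohomology_cup X R 1 1 u1 ` carrier (cohomology X R 1)
       \<and> restricted_massey X R u1 u2 \<in>
           rcosets\<^bsub>cohomology X R 2\<^esub> (cohomology_cup X R 1 1 u1 ` carrier (cohomology X R 1))"
proof -
  interpret delta_complex X by (rule assms(2))
  interpret halving_ring R
    using assms(1) halving_ring_int halving_ring_residue_ring by blast
  interpret halving_cochain_complex X R ..
  show ?thesis
    using restricted_massey_indeterminacy[OF assms(3-5)] by blast
qed

end
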